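(* Let $n,c\in\mathbb{N}$ and $\mathbf{y}=(c^n)=(c,c,\ldots,c)\in\mathbb{N}^n$. Then $|\mathsf{PA}^{\mathrm{inv}}_n(\mathbf{y})|=(n+1)^{n-1}$.
   Context: $\mathbb{N}=\{1,2,3,\ldots\}$ and $[k]=\{1,\ldots,k\}$. Let $\mathbf{y}=(y_1,\ldots,y_n)\in\mathbb{N}^n$ be car lengths and $m=\sum_{i=1}^n y_i$. A one-way street has spots $1,\ldots,m$, initially empty. Given preferences $\mathbf{x}=(x_1,\ldots,x_n)\in[m]^n$, cars $1,\ldots,n$ enter in this order; car $i$ parks in spots $j,j+1,\ldots,j+y_i-1$, where $j\ge x_i$ is the smallest integer such that $j+y_i-1\le m$ and all these spots are unoccupied; if no such $j$ exists, parking fails. If all cars park, $\mathbf{x}$ is a parking assortment for $\mathbf{y}$; $\mathsf{PA}_n(\mathbf{y})$ is the set of these. $\mathsf{PA}^{\mathrm{inv}}_n(\mathbf{y})$ is the set of (permutation) invariant parking assortments: those $\mathbf{x}\in\mathsf{PA}_n(\mathbf{y})$ all of whose rearrangements are also in $\mathsf{PA}_n(\mathbf{y})$ (with $\mathbf{y}$ fixed). *)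

theory Defs
  imports Main "HOL-Library.Multiset"
begin

text \<open>
  Spots are the naturals \<open>1, \<dots>, m\<close>. Preferences \<open>xs\<close> and car lengths \<open>ys\<close> are lists indexed by
  cars in order of entry; lengths are assumed positive throughout.
\<close>

text \<open>
  \<open>j + y \<le> m + 1\<close> is \<open>j + y - 1 \<le> m\<close> without truncated subtraction.
\<close>
definition can_park :: "nat \<Rightarrow> nat set \<Rightarrow> nat \<Rightarrow> nat \<Rightarrow> nat \<Rightarrow> bool" where
  "can_park m occ x y j \<longleftrightarrow> x \<le> j \<and> j + y \<le> m + 1 \<and> {j..<j + y} \<inter> occ = {}"

fun all_park :: "nat \<Rightarrow> nat set \<Rightarrow> nat list \<Rightarrow> nat list \<Rightarrow> bool" where
  "all_park m occ [] [] \<longleftrightarrow> True"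
| "all_park m occ (x # xs) (y # ys) \<longleftrightarrow>
     (\<exists>j. can_park m occ x y j) \<and>
     (let j = (LEAST j. can_park m occ x y j) in all_park m (occ \<union> {j..<j + y}) xs ys)"
| "all_park m occ _ _ \<longleftrightarrow> False"

definition parking_assortments :: "nat list \<Rightarrow> nat list set" where
  "parking_assortments ys =
     {xs. length xs = length ys \<and> set xs \<subseteq> {1..sum_list ys} \<and> all_park (sum_list ys) {} xs ys}"

definition invariant_parking_assortments :: "nat list \<Rightarrow> nat list set" where
  "invariant_parking_assortments ys =
     {xs \<in> parking_assortments ys. \<forall>xs'. mset xs' = mset xs \<longrightarrow> xs' \<in> parking_assortments ys}"

end

theory Submission
  imports Defs
begin

text \<open>
  If \<open>x\<close> occurs in an invariant parking assortment, let the car preferring \<open>x\<close> enter first: it parks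
  at \<open>x\<close>, and the \<open>x - 1\<close> spots to its left must be filled by cars of length \<open>c\<close>, so
  \<open>x \<equiv> 1\<close> modulo \<open>c\<close>. With all preferences of this form the street behaves like \<open>n\<close> unit spots, so
  one is left with classical parking functions, which are characterized by the number of large
  preferences (hence are permutation invariant). They are counted by Pollak's argument: among the
  \<open>n + 1\<close> cyclic shifts of a word in \<open>(\<int>/(n + 1))\<^sup>n\<close> exactly one is a parking function.
\<close>

section \<open>Classical parking functions on \<open>n\<close> places numbered from
  \<open>0\<close>\<close>

text \<open>The condition bounds the demand for the places from \<open>k\<close> on by their number.
  Truncated subtraction makes this bound \<open>0\<close> for \<open>k \<ge> n\<close>, which keeps
  all entries below \<open>n\<close>.\<close>

definition parking_functions :: "nat \<Rightarrow> nat list set" where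
  "parking_functions n = {zs. length zs = n \<and> (\<forall>k. length (filter ((\<le>) k) zs) \<le> n - k)}"

definition cyclic_shift :: "nat \<Rightarrow> nat \<Rightarrow> nat list \<Rightarrow> nat list" where
  "cyclic_shift N t = map (\<lambda>a. (a + t) mod N)"

lemma length_filter_less_plus_ge:
  fixes k :: "'a::linorder"
  shows "length (filter (\<lambda>a. a < k) zs) + length (filter ((\<le>) k) zs) = length zs"
  by (induction zs) auto

text \<open>Passing to complementary counts suits cyclic shifts, while the defining form suits the
  induction over cars. Values \<open>k > n\<close> add nothing, as the case \<open>k = n\<close>
  already puts all entries below \<open>n\<close>.\<close>

lemma parking_functions_iff:
  "zs \<in> parking_functions n \<longleftrightarrow>
     length zs = n \<and> (\<forall>k\<le>n. k \<le> length (filter (\<lambda>a. a < k) zs))"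
proof -
  have "(\<forall>k. length (filter ((\<le>) k) zs) \<le> n - k) \<longleftrightarrow>
      (\<forall>k\<le>n. k \<le> length (filter (\<lambda>a. a < k) zs))" if len: "length zs = n"
  proof safe
    fix k assume *: "\<forall>k. length (filter ((\<le>) k) zs) \<le> n - k" "k \<le> n"
    then show "k \<le> length (filter (\<lambda>a. a < k) zs)"
      using length_filter_less_plus_ge[of k zs] spec[OF *(1), of k] len by linarith
  next
    fix k assume *: "\<forall>k\<le>n. k \<le> length (filter (\<lambda>a. a < k) zs)"
    show "length (filter ((\<le>) k) zs) \<le> n - k"
    proof (cases "k \<le> n")
      case True
      then show ?thesis
        using length_filter_less_plus_ge[of k zs] spec[OF *, of k] len by linarith
    next
      case False
      have "length (filter ((\<le>) n) zs) = 0"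
        using length_filter_less_plus_ge[of n zs] spec[OF *, of n] len by linarith
      then have "\<forall>a\<in>set zs. a < n" by (simp add: filter_empty_conv not_le)
      with False have "filter ((\<le>) k) zs = []" by (auto simp: filter_empty_conv)
      then show ?thesis by simp
    qed
  qed
  then show ?thesis by (auto simp: parking_functions_def)
qed

lemma parking_functions_less:
  assumes "zs \<in> parking_functions n" "a \<in> set zs"
  shows "a < n"
proof -
  have "length (filter ((\<le>) n) zs) \<le> n - n"
    using assms(1) by (simp only: parking_functions_def mem_Collect_eq)
  then have "filter ((\<le>) n) zs = []" by simp
  with assms(2) show ?thesis by (auto simp: filter_empty_conv not_le)
qed

lemma parking_functions_mset:
  assumes "zs \<in> parking_functions n" "mset zs' = mset zs"
  shows "zs' \<in> parking_functions n"
proof -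
  have "length (filter P zs') = length (filter P zs)" for P
    using assms(2) by (metis mset_filter size_mset)
  moreover have "length zs' = length zs" using assms(2) by (rule mset_eq_length)
  ultimately show ?thesis using assms(1) by (simp add: parking_functions_def)
qed

section \<open>Cyclic shifts and Pollak's count\<close>

lemma cyclic_shift_simps [simp]:
  "length (cyclic_shift N t zs) = length zs"
  "cyclic_shift N s (cyclic_shift N t zs) = cyclic_shift N (s + t) zs"
  by (auto simp: cyclic_shift_def mod_simps add_ac)

lemma cyclic_shift_self: "set zs \<subseteq> {..<N} \<Longrightarrow> cyclic_shift N N zs = zs"
  by (auto simp: cyclic_shift_def intro!: map_idI)

lemma set_cyclic_shift: "0 < N \<Longrightarrow> set (cyclic_shift N t zs) \<subseteq> {..<N}"
  by (auto simp: cyclic_shift_def)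

text \<open>Shifting by \<open>N - t\<close> subtracts \<open>t\<close> modulo \<open>N\<close>, so
  it carries the cyclic interval of length \<open>j\<close> starting at \<open>t\<close> to the
  residues below \<open>j\<close>. The second case is the interval that wraps past
  \<open>N\<close>.\<close>

lemma cyclic_shift_less_iff:
  fixes a :: nat
  assumes "a < N" "t \<le> N" "j \<le> N"
  shows "(a + (N - t)) mod N < j \<longleftrightarrow>
    (if t + j \<le> N then t \<le> a \<and> a < t + j else t \<le> a \<or> a < t + j - N)"
proof (cases "t \<le> a")
  case True
  then have "(a + (N - t)) mod N = a - t"
    using assms mod_add_self2[of "a - t" N] by (simp add: algebra_simps)
  then show ?thesis using True assms by auto
next
  case False
  then have "(a + (N - t)) mod N = a + (N - t)" using assms by simp
  then show ?thesis using False assms by auto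
qed

lemma count_less_cyclic_shift:
  assumes "set zs \<subseteq> {..<N}" "t \<le> N" "j \<le> N"
  shows "length (filter (\<lambda>a. a < j) (cyclic_shift N (N - t) zs)) + length (filter (\<lambda>a. a < t) zs) =
    (if t + j \<le> N then length (filter (\<lambda>a. a < t + j) zs)
     else length zs + length (filter (\<lambda>a. a < t + j - N) zs))"
  using assms
proof (induction zs)
  case (Cons a zs)
  then have "a < N" by simp
  show ?case using Cons cyclic_shift_less_iff[OF \<open>a < N\<close> assms(2,3)]
    by (auto simp: cyclic_shift_def split: if_splits)
qed (auto simp: cyclic_shift_def)

text \<open>For \<open>s = Suc n - t\<close>, the entries below \<open>t\<close> after the shift
  come from the entries that are at least \<open>s\<close> before it. If both words were parking
  functions, the \<open>n\<close> entries would split into at least \<open>t\<close> and at least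
  \<open>s\<close>, although \<open>s + t = Suc n\<close>.\<close>

lemma cyclic_shift_parking_function_unique:
  assumes "zs \<in> parking_functions n" "0 < t" "t \<le> n"
  shows "cyclic_shift (Suc n) t zs \<notin> parking_functions n"
proof
  assume shifted: "cyclic_shift (Suc n) t zs \<in> parking_functions n"
  define s where "s = Suc n - t"
  have sub: "set zs \<subseteq> {..<Suc n}" using parking_functions_less[OF assms(1)] by fastforce
  have len: "length (filter (\<lambda>a. a < Suc n) zs) = n"
    using sub assms(1) by (subst filter_True) (auto simp: parking_functions_def)
  have "length (filter (\<lambda>a. a < t) (cyclic_shift (Suc n) (Suc n - s) zs)) +
      length (filter (\<lambda>a. a < s) zs) = n"
    using count_less_cyclic_shift[OF sub, of s t] len assms by (simp add: s_def)
  moreover have "Suc n - s = t" using assms by (simp add: s_def)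
  moreover have "t \<le> length (filter (\<lambda>a. a < t) (cyclic_shift (Suc n) t zs))"
    using shifted assms by (simp add: parking_functions_iff)
  moreover have "s \<le> length (filter (\<lambda>a. a < s) zs)"
    using assms by (simp add: parking_functions_iff s_def)
  moreover have "s + t = Suc n" using assms by (simp add: s_def)
  ultimately show False by simp
qed

lemma cyclic_shift_parking_function_exists:
  assumes sub: "set zs \<subseteq> {..<Suc n}" and len: "length zs = n"
  obtains t where "0 < t" "t \<le> Suc n" "cyclic_shift (Suc n) (Suc n - t) zs \<in> parking_functions n"
proof -
  \<comment> \<open>The word is cut at the first minimum \<open>t\<close> of the walk \<open>S\<close>.\<close>
  define S where "S = (\<lambda>k. int (length (filter (\<lambda>a. a < k) zs)) - int k)"
  define M where "M = Min (S ` {..Suc n})"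
  have min: "M \<le> S k" if "k \<le> Suc n" for k using that by (simp add: M_def)
  have "M \<in> S ` {..Suc n}" unfolding M_def by (rule Min_in) auto
  then have ex: "\<exists>t. t \<le> Suc n \<and> S t = M" by auto
  define t where "t = (LEAST t. t \<le> Suc n \<and> S t = M)"
  have t: "t \<le> Suc n" "S t = M" using LeastI_ex[OF ex] by (auto simp: t_def)
  have first: "S t < S k" if "k < t" for k
    using not_less_Least[of k "\<lambda>t. t \<le> Suc n \<and> S t = M"] that t min[of k] by (auto simp: t_def)
  have "length (filter (\<lambda>a. a < Suc n) zs) = n"
    using sub len by (subst filter_True) auto
  then have Sn: "S (Suc n) = -1" by (simp add: S_def)
  have "S t \<noteq> S 0" using Sn t min[of "Suc n"] by (simp add: S_def)
  then have "t \<noteq> 0" by metis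
  moreover have "cyclic_shift (Suc n) (Suc n - t) zs \<in> parking_functions n"
    unfolding parking_functions_iff
  proof (intro conjI allI impI)
    fix j assume j: "j \<le> n"
    show "j \<le> length (filter (\<lambda>a. a < j) (cyclic_shift (Suc n) (Suc n - t) zs))"
    proof (cases "t + j \<le> Suc n")
      case True
      then show ?thesis
        using count_less_cyclic_shift[OF sub t(1), of j] j min[OF True] t(2)
        by (simp add: S_def)
    next
      case False
      \<comment> \<open>Wrapping costs \<open>1\<close> because \<open>S (Suc n) = -1\<close>; the
        strict inequality \<open>S t < S k\<close> at the first minimum makes up for it.\<close>
      define k where "k = t + j - Suc n"
      have "k < t" "k + Suc n = t + j" using False j by (auto simp: k_def)
      then show ?thesis
        using count_less_cyclic_shift[OF sub t(1), of j] j False first[of k] len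
        by (simp add: S_def flip: k_def)
    qed
  qed (simp add: len)
  ultimately show ?thesis using that[of t] t by simp
qed

text \<open>Pairs of a parking function and a shift below \<open>Suc n\<close> correspond
  bijectively to all \<open>Suc n ^ n\<close> words, so one factor \<open>Suc n\<close> is divided
  out.\<close>

lemma card_parking_functions:
  assumes "n \<ge> 1"
  shows "card (parking_functions n) = (n + 1) ^ (n - 1)"
proof -
  let ?W = "{zs. set zs \<subseteq> {..<Suc n} \<and> length zs = n}"
  let ?F = "\<lambda>(zs, t). cyclic_shift (Suc n) t zs"
  have sub: "set zs \<subseteq> {..<Suc n}" if "zs \<in> parking_functions n" for zs
    using parking_functions_less[OF that] by fastforce
  \<comment> \<open>Undoing the smaller shift \<open>s\<close> exhibits \<open>zs\<close> as
    \<open>ws\<close> shifted by \<open>t - s \<le> n\<close>, and uniqueness then forces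
    \<open>t - s = 0\<close>.\<close>
  have aux: "zs = ws \<and> s = t"
    if "zs \<in> parking_functions n" "ws \<in> parking_functions n" "s \<le> t" "t \<le> n"
      "cyclic_shift (Suc n) s zs = cyclic_shift (Suc n) t ws" for zs ws s t
  proof -
    have "zs = cyclic_shift (Suc n) (Suc n - s) (cyclic_shift (Suc n) s zs)"
      using that(3,4) cyclic_shift_self[OF sub[OF that(1)]] by simp
    also have "\<dots> = cyclic_shift (Suc n) (t - s) (cyclic_shift (Suc n) (Suc n) ws)"
    proof -
      have "Suc n - s + t = t - s + Suc n" using that(3,4) by simp
      then show ?thesis by (simp only: that(5) cyclic_shift_simps)
    qed
    finally have zs: "zs = cyclic_shift (Suc n) (t - s) ws"
      using that by (simp only: cyclic_shift_self[OF sub])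
    moreover have "t - s \<le> n" using that(4) by simp
    ultimately have "t - s = 0"
      using cyclic_shift_parking_function_unique[of ws n "t - s"] that(1,2) by blast
    moreover have "cyclic_shift (Suc n) 0 ws = ws"
      using sub[of ws] that by (auto simp: cyclic_shift_def intro!: map_idI)
    ultimately show ?thesis using that(3) zs by simp
  qed
  have "bij_betw ?F (parking_functions n \<times> {..<Suc n}) ?W"
  proof (rule bij_betw_imageI)
    show "inj_on ?F (parking_functions n \<times> {..<Suc n})"
    proof (rule inj_onI, clarify)
      fix zs s ws t
      assume "zs \<in> parking_functions n" "ws \<in> parking_functions n" "s < Suc n" "t < Suc n"
        "cyclic_shift (Suc n) s zs = cyclic_shift (Suc n) t ws"
      then show "zs = ws \<and> s = t" using aux[of zs ws s t] aux[of ws zs t s]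
        by (cases "s \<le> t") auto
    qed
    show "?F ` (parking_functions n \<times> {..<Suc n}) = ?W"
    proof (intro equalityI subsetI)
      fix zs assume "zs \<in> ?F ` (parking_functions n \<times> {..<Suc n})"
      then show "zs \<in> ?W" using set_cyclic_shift[of "Suc n"]
        by (force simp: parking_functions_def)
    next
      fix zs assume zs: "zs \<in> ?W"
      define N where "N = Suc n"
      obtain t where t: "0 < t" "t \<le> N" "cyclic_shift N (N - t) zs \<in> parking_functions n"
        using cyclic_shift_parking_function_exists[of zs n] zs unfolding N_def by blast
      \<comment> \<open>Here \<open>t\<close> ranges over \<open>1, ..., N\<close> but shifts in the
        pairs are below \<open>N\<close>, so \<open>t = N\<close> is represented by
        \<open>0\<close>.\<close>
      have "cyclic_shift N (t mod N) (cyclic_shift N (N - t) zs) =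
          cyclic_shift N t (cyclic_shift N (N - t) zs)"
        by (simp only: cyclic_shift_def mod_simps)
      also have "\<dots> = zs"
        using t zs cyclic_shift_self[of zs N] by (simp add: N_def)
      finally have "zs = ?F (cyclic_shift N (N - t) zs, t mod N)" by (simp add: N_def)
      moreover have "t mod N < Suc n" by (simp add: N_def)
      ultimately show "zs \<in> ?F ` (parking_functions n \<times> {..<Suc n})" using t(3) by blast
    qed
  qed
  then have "card (parking_functions n \<times> {..<Suc n}) = card ?W" by (rule bij_betw_same_card)
  then have "card (parking_functions n) * Suc n = Suc n ^ n"
    by (simp add: card_cartesian_product card_lists_length_eq)
  also have "\<dots> = Suc n ^ (n - 1) * Suc n" using assms by (cases n) auto
  finally show ?thesis by (simp only: mult_cancel2) simp
qed

section \<open>Gaps to the left of an occupied spot\<close>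

text \<open>The remaining cars fill the street exactly, and none can straddle the occupied spot
  \<open>Suc p\<close>. Hence the free spots up to \<open>p\<close> are eventually partitioned into
  whole cars, whose lengths are multiples of \<open>c\<close>.\<close>

lemma all_park_dvd_gap:
  assumes "all_park m occ xs ys" "\<forall>y\<in>set ys. c dvd y" "0 \<notin> set xs"
    "occ \<subseteq> {1..m}" "card occ + sum_list ys = m" "Suc p \<in> occ"
  shows "c dvd card ({1..p} - occ)"
  using assms
proof (induction m occ xs ys rule: all_park.induct)
  case (1 m occ)
  then have "occ = {1..m}" by (intro card_subset_eq) auto
  with 1 have "{1..p} - occ = {}" by auto
  then show ?case by (simp only: card.empty dvd_0_right)
next
  case (2 m occ x xs y ys)
  define j where "j = (LEAST j. can_park m occ x y j)"
  let ?I = "{j..<j + y}"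
  have j: "can_park m occ x y j"
    using 2(2) unfolding j_def by (auto intro: LeastI_ex)
  then have I: "?I \<subseteq> {1..m}" "?I \<inter> occ = {}" "1 \<le> j"
    using 2(4) by (auto simp: can_park_def)
  have fin: "finite occ" using 2(5) finite_subset by blast
  have "card (occ \<union> ?I) = card occ + y"
    using I fin by (subst card_Un_disjoint) auto
  then have IH: "c dvd card ({1..p} - (occ \<union> ?I))"
    using 2 I by (intro 2(1)[OF j_def]) (auto simp: Let_def j_def)
  show ?case
  proof (cases "j \<le> p \<and> 0 < y")
    case True
    \<comment> \<open>A nonempty interval starting at or before \<open>p\<close> would have to
      contain \<open>Suc p\<close> in order to extend beyond \<open>p\<close>.\<close>
    then have "?I \<subseteq> {1..p}"
      using I 2(7) by (auto simp: disjoint_iff)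
        (meson le_Suc_eq le_less_trans not_le not_less_eq_eq)
    then have "card ({1..p} - occ) = card ({1..p} - (occ \<union> ?I)) + card ?I"
      using I by (subst card_Un_disjoint[symmetric]) (auto intro!: arg_cong[where f = card])
    then show ?thesis using IH 2(3) by simp
  next
    case False
    then have "{1..p} - (occ \<union> ?I) = {1..p} - occ" by auto
    with IH show ?thesis by simp
  qed
qed auto

text \<open>The first car occupies \<open>x\<close> itself and leaves all of
  \<open>{1..x - 1}\<close> free, so the gap argument applies with \<open>p = x - 1\<close>.\<close>

lemma parking_assortments_hd_cong:
  assumes "x # xs \<in> parking_assortments ys" "\<forall>y\<in>set ys. 0 < y \<and> c dvd y"
  shows "c dvd x - 1"
proof -
  obtain y ys' where ys: "ys = y # ys'"
    using assms(1) by (cases ys) (auto simp: parking_assortments_def)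
  let ?m = "sum_list ys"
  have park: "\<exists>j. can_park ?m {} x y j"
    and all: "all_park ?m {(LEAST j. can_park ?m {} x y j)..<(LEAST j. can_park ?m {} x y j) + y} xs ys'"
    and sub: "0 \<notin> set xs" "1 \<le> x"
    using assms(1) by (auto simp: parking_assortments_def ys Let_def)
  \<comment> \<open>On the empty street only the right end obstructs, so if some
    \<open>j \<ge> x\<close> fits, then \<open>x\<close> fits.\<close>
  have x: "can_park ?m {} x y x" using park by (auto simp: can_park_def)
  have "(LEAST j. can_park ?m {} x y j) = x"
    using x by (rule Least_equality) (simp add: can_park_def)
  with all have "all_park ?m {x..<x + y} xs ys'" by simp
  then have "c dvd card ({1..x - 1} - {x..<x + y})"
    using assms(2) sub x by (rule_tac all_park_dvd_gap) (auto simp: ys can_park_def)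
  also have "{1..x - 1} - {x..<x + y} = {1..x - 1}" by auto
  finally show ?thesis by simp
qed

section \<open>Reduction to \<open>n\<close> blocks of \<open>c\<close> spots\<close>

lemma can_park_blocks_iff:
  fixes B :: "nat set"
  assumes "0 < c"
  defines "occ \<equiv> \<Union>b\<in>B. {c * b + 1..<c * b + 1 + c}"
  shows "can_park (n * c) occ (c * z + 1) c (c * b + 1) \<longleftrightarrow> z \<le> b \<and> b < n \<and> b \<notin> B"
proof -
  have "{c * b + 1..<c * b + 1 + c} \<inter> occ = {} \<longleftrightarrow> b \<notin> B"
  proof
    assume "{c * b + 1..<c * b + 1 + c} \<inter> occ = {}"
    then have "c * b + 1 \<notin> occ" using assms by (auto simp: disjoint_iff)
    with assms show "b \<notin> B" by auto
  next
    \<comment> \<open>Blocks are disjoint because a spot determines its block index.\<close>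
    have eq: "b' = (x - 1) div c" if "x \<in> {c * b' + 1..<c * b' + 1 + c}" for b' x
      using that by (intro sym[OF div_nat_eqI]) (auto simp: algebra_simps)
    assume "b \<notin> B"
    then show "{c * b + 1..<c * b + 1 + c} \<inter> occ = {}"
      unfolding occ_def using eq by blast
  qed
  moreover have "c * b + 1 + c \<le> n * c + 1 \<longleftrightarrow> b < n"
    using assms mult_le_cancel1[of c "Suc b" n] by (simp add: algebra_simps Suc_le_eq less_Suc_eq_le)
  ultimately show ?thesis using assms by (simp add: can_park_def)
qed

text \<open>Occupied spots form whole blocks, so if spot \<open>j\<close> is free, then so is the
  block containing it. Since the preference is itself a block start, moving \<open>j\<close> back to
  the start of its block does not pass it; thus a least position is always a block start.\<close>

lemma can_park_blocks_round_down:
  fixes B :: "nat set"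
  assumes "0 < c"
  defines "occ \<equiv> \<Union>b\<in>B. {c * b + 1..<c * b + 1 + c}"
  assumes j: "can_park (n * c) occ (c * z + 1) c j"
  shows "can_park (n * c) occ (c * z + 1) c (c * ((j - 1) div c) + 1)"
proof -
  define b where "b = (j - 1) div c"
  have jb: "j = c * b + (j - 1) mod c + 1" and r: "(j - 1) mod c < c"
    using j assms by (auto simp: b_def can_park_def)
  have "c * z \<le> j - 1" using j by (auto simp: can_park_def)
  then have "z \<le> b" using assms by (simp add: b_def less_eq_div_iff_mult_less_eq mult.commute)
  moreover have "c * b + c < n * c + 1" using j jb by (simp add: can_park_def)
  then have "b < n" using assms mult_le_cancel1[of c "Suc b" n] by (simp add: algebra_simps Suc_le_eq)
  moreover have "j \<in> {c * b + 1..<c * b + 1 + c}" using jb r by auto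
  then have "b \<notin> B" using j assms by (auto simp: can_park_def disjoint_iff)
  ultimately show ?thesis
    unfolding occ_def can_park_blocks_iff[OF assms(1)] b_def[symmetric] by blast
qed

lemma Least_can_park_blocks:
  fixes B :: "nat set"
  assumes "0 < c"
  defines "occ \<equiv> \<Union>b\<in>B. {c * b + 1..<c * b + 1 + c}"
  assumes ex: "\<exists>b. z \<le> b \<and> b < n \<and> b \<notin> B"
  shows "(LEAST j. can_park (n * c) occ (c * z + 1) c j) =
    c * (LEAST b. z \<le> b \<and> b < n \<and> b \<notin> B) + 1"
proof (rule Least_equality)
  show "can_park (n * c) occ (c * z + 1) c (c * (LEAST b. z \<le> b \<and> b < n \<and> b \<notin> B) + 1)"
    unfolding occ_def can_park_blocks_iff[OF assms(1)] by (rule LeastI_ex[OF ex])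
next
  fix j assume j: "can_park (n * c) occ (c * z + 1) c j"
  have "(LEAST b. z \<le> b \<and> b < n \<and> b \<notin> B) \<le> (j - 1) div c"
    using can_park_blocks_round_down[OF assms(1) j[unfolded occ_def]]
    unfolding can_park_blocks_iff[OF assms(1)] by (rule Least_le)
  then have "c * (LEAST b. z \<le> b \<and> b < n \<and> b \<notin> B) \<le> c * ((j - 1) div c)" by simp
  also have "\<dots> \<le> j - 1" by simp
  finally show "c * (LEAST b. z \<le> b \<and> b < n \<and> b \<notin> B) + 1 \<le> j"
    using j by (auto simp: can_park_def)
qed

text \<open>A Hall-type criterion: for every \<open>k\<close>, demand from block \<open>k\<close> on
  is at most the number of free blocks there. The induction keeps \<open>B\<close> arbitrary, since
  each car adds its block to \<open>B\<close>.\<close>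

lemma all_park_blocks_iff:
  assumes "0 < c"
  shows "all_park (n * c) (\<Union>b\<in>B. {c * b + 1..<c * b + 1 + c})
      (map (\<lambda>z. c * z + 1) zs) (replicate (length zs) c) \<longleftrightarrow>
    (\<forall>k. length (filter ((\<le>) k) zs) \<le> card ({k..<n} - B))"
proof (induction zs arbitrary: B)
  case (Cons z zs)
  let ?occ = "\<lambda>B. \<Union>b\<in>B. {c * b + 1..<c * b + 1 + c}"
  let ?free = "\<lambda>b. z \<le> b \<and> b < n \<and> b \<notin> B"
  define b where "b = (LEAST b. ?free b)"
  have ex_iff: "(\<exists>j. can_park (n * c) (?occ B) (c * z + 1) c j) \<longleftrightarrow> (\<exists>b. ?free b)"
    using can_park_blocks_round_down[OF assms] can_park_blocks_iff[OF assms] by blast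
  show ?case
  proof (cases "\<exists>b. ?free b")
    case False
    \<comment> \<open>The criterion fails at \<open>k = z\<close>: no block is free there, yet the
      current car is counted.\<close>
    then have "{z..<n} - B = {}" by auto
    then have "\<not> length (filter ((\<le>) z) (z # zs)) \<le> card ({z..<n} - B)" by (simp only:) simp
    moreover have "\<not> all_park (n * c) (?occ B) (map (\<lambda>z. c * z + 1) (z # zs)) (replicate (length (z # zs)) c)"
      using False ex_iff by simp
    ultimately show ?thesis by blast
  next
    case True
    have b: "?free b" unfolding b_def by (rule LeastI_ex[OF True])
    have occupied: "a \<in> B" if "z \<le> a" "a < b" for a
      using not_less_Least[of a ?free] that b by (auto simp: b_def)
    define F where "F C k = card ({k..<n} - C)" for C k
    have F_le: "F B k = Suc (F (insert b B) k)" if "k \<le> b" for k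
    proof -
      have "{k..<n} - B = insert b ({k..<n} - insert b B)" using that b by auto
      then have "F B k = card (insert b ({k..<n} - insert b B))" unfolding F_def by (rule arg_cong)
      then show ?thesis by (simp add: F_def)
    qed
    have F_gt: "F (insert b B) k = F B k" if "b < k" for k
      unfolding F_def using that by (intro arg_cong[where f = card]) auto
    \<comment> \<open>All blocks from \<open>z\<close> up to, but excluding, \<open>b\<close> are
      occupied, so the free count does not change between them.\<close>
    have F_gap: "F B z = F B k" if "z \<le> k" "k \<le> b" for k
    proof -
      have "a \<in> {z..<n} - B \<longleftrightarrow> a \<in> {k..<n} - B" for a
        using that occupied[of a] by (cases "a < k") auto
      then have "{z..<n} - B = {k..<n} - B" by blast
      then show ?thesis by (simp only: F_def)
    qed
    have occ: "?occ B \<union> {c * b + 1..<c * b + 1 + c} = ?occ (insert b B)" by auto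
    have Least: "(LEAST j. can_park (n * c) (?occ B) (c * z + 1) c j) = c * b + 1"
      unfolding b_def by (rule Least_can_park_blocks[OF assms True])
    have "all_park (n * c) (?occ B) (map (\<lambda>z. c * z + 1) (z # zs)) (replicate (length (z # zs)) c)
        \<longleftrightarrow> all_park (n * c) (?occ (insert b B)) (map (\<lambda>z. c * z + 1) zs) (replicate (length zs) c)"
      by (simp only: list.map length_Cons replicate_Suc all_park.simps Let_def ex_iff True Least occ simp_thms)
    also have "\<dots> \<longleftrightarrow> (\<forall>k. length (filter ((\<le>) k) zs) \<le> F (insert b B) k)"
      unfolding F_def by (rule Cons.IH)
    also have "\<dots> \<longleftrightarrow> (\<forall>k. length (filter ((\<le>) k) (z # zs)) \<le> F B k)"
    proof (intro iffI allI)
      fix k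
      assume "\<forall>k. length (filter ((\<le>) k) zs) \<le> F (insert b B) k"
      then have "length (filter ((\<le>) k) zs) \<le> F (insert b B) k" ..
      then show "length (filter ((\<le>) k) (z # zs)) \<le> F B k"
        using F_le[of k] F_gt[of k] b by (cases "k \<le> b") auto
    next
      fix k
      assume *: "\<forall>k. length (filter ((\<le>) k) (z # zs)) \<le> F B k"
      consider "k \<le> z" | "z < k" "k \<le> b" | "b < k" by linarith
      then show "length (filter ((\<le>) k) zs) \<le> F (insert b B) k"
      proof cases
        case 1
        then show ?thesis using spec[OF *, of k] F_le[of k] b by simp
      next
        case 2
        \<comment> \<open>Here parking lowers the supply from \<open>k\<close> on but not the
          demand. The missing unit comes from the condition at \<open>z\<close>, where the current
          car is counted and the supply is the same.\<close>
        have "filter ((\<le>) k) zs = filter ((\<le>) k) (filter ((\<le>) z) zs)"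
          using 2 by (auto intro: filter_cong)
        then have "length (filter ((\<le>) k) zs) \<le> length (filter ((\<le>) z) zs)"
          by (metis length_filter_le)
        then have "Suc (length (filter ((\<le>) k) zs)) \<le> F B z"
          using spec[OF *, of z] by simp
        then show ?thesis using F_le[of k] F_gap[of k] 2 by simp
      next
        case 3
        then show ?thesis using spec[OF *, of k] F_gt[of k] by (auto split: if_splits)
      qed
    qed
    finally show ?thesis unfolding F_def .
  qed
qed simp

text \<open>On the empty street the block criterion reads \<open>n - k\<close>, the defining bound
  of \<open>parking_functions\<close>; entries below \<open>n\<close> give preferences within the
  street.\<close>

lemma map_mem_parking_assortments_iff:
  assumes "0 < c"
  shows "map (\<lambda>z. c * z + 1) zs \<in> parking_assortments (replicate n c) \<longleftrightarrow> zs \<in> parking_functions n"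
proof -
  have park: "all_park (n * c) {} (map (\<lambda>z. c * z + 1) zs) (replicate n c) \<longleftrightarrow>
      zs \<in> parking_functions n" if "length zs = n"
    using all_park_blocks_iff[OF assms, of n "{}" zs] that by (simp add: parking_functions_def)
  have "c * z + 1 \<in> {1..n * c}" if "zs \<in> parking_functions n" "z \<in> set zs" for z
  proof -
    have "c * Suc z \<le> c * n"
      using parking_functions_less[OF that] by (intro mult_le_mono2) simp
    with assms show ?thesis by (simp add: algebra_simps)
  qed
  then show ?thesis
    using park by (auto simp: parking_assortments_def sum_list_replicate parking_functions_def image_subset_iff)
qed

section \<open>Invariant assortments as encoded parking functions\<close>

lemma invariant_parking_assortments_replicate:
  assumes "0 < c"
  shows "invariant_parking_assortments (replicate n c) = map (\<lambda>z. c * z + 1) ` parking_functions n"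
proof (intro equalityI subsetI)
  fix xs assume xs: "xs \<in> invariant_parking_assortments (replicate n c)"
  have "c * ((x - 1) div c) + 1 = x" if x: "x \<in> set xs" for x
  proof -
    \<comment> \<open>Invariance allows any entry to be moved to the front, where the congruence for
      the first car applies.\<close>
    have "x # remove1 x xs \<in> parking_assortments (replicate n c)"
      using xs x by (simp add: invariant_parking_assortments_def)
    moreover from this have "1 \<le> x" by (simp add: parking_assortments_def)
    moreover have "\<forall>y\<in>set (replicate n c). 0 < y \<and> c dvd y" using assms by simp
    ultimately have "c dvd x - 1" by (blast intro: parking_assortments_hd_cong)
    with \<open>1 \<le> x\<close> show ?thesis by simp
  qed
  then have eq: "map (\<lambda>z. c * z + 1) (map (\<lambda>x. (x - 1) div c) xs) = xs"
    by (simp add: map_idI)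
  moreover have "xs \<in> parking_assortments (replicate n c)"
    using xs by (simp add: invariant_parking_assortments_def)
  ultimately have "map (\<lambda>x. (x - 1) div c) xs \<in> parking_functions n"
    using map_mem_parking_assortments_iff[OF assms] by metis
  then show "xs \<in> map (\<lambda>z. c * z + 1) ` parking_functions n"
    using eq by (metis imageI)
next
  fix xs assume "xs \<in> map (\<lambda>z. c * z + 1) ` parking_functions n"
  then obtain zs where zs: "zs \<in> parking_functions n" "xs = map (\<lambda>z. c * z + 1) zs" by blast
  have "xs' \<in> parking_assortments (replicate n c)" if "mset xs' = mset xs" for xs'
  proof -
    let ?zs = "map (\<lambda>x. (x - 1) div c) xs'"
    \<comment> \<open>Decoding by \<open>(x - 1) div c\<close> inverts the encoding, so a
      rearrangement of \<open>xs\<close> decodes to a rearrangement of \<open>zs\<close>.\<close>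
    have "mset ?zs = mset zs" using that zs assms by (simp add: image_mset.compositionality o_def)
    then have "?zs \<in> parking_functions n" by (rule parking_functions_mset[OF zs(1)])
    then have "map (\<lambda>z. c * z + 1) ?zs \<in> parking_assortments (replicate n c)"
      by (simp only: map_mem_parking_assortments_iff[OF assms])
    moreover have "set xs' = set xs" using that by (rule mset_eq_setD)
    then have "map (\<lambda>z. c * z + 1) ?zs = xs'"
      using zs(2) assms by (auto intro!: map_idI)
    ultimately show ?thesis by (simp only:)
  qed
  then show "xs \<in> invariant_parking_assortments (replicate n c)"
    by (simp add: invariant_parking_assortments_def)
qed

theorem corollary3p4:
  fixes n c :: nat
  assumes "n \<ge> 1" and "c \<ge> 1"
  shows "card (invariant_parking_assortments (replicate n c)) = (n + 1) ^ (n - 1)"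
proof -
  have "inj (map (\<lambda>z. c * z + 1))" using assms by (auto intro: injI)
  then show ?thesis
    using assms by (simp add: invariant_parking_assortments_replicate card_parking_functions
        card_image inj_on_subset[OF _ subset_UNIV])
qed

end
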